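(* Let $S\subset\mathbb{R}^2$ be a compact, $1$-purely unrectifiable set with $\mathcal{H}^1(S)<\infty$. Then there exists a sequence of $1$-Lipschitz maps $f_i\colon\mathbb{R}^2\to\mathbb{R}^2$ (with respect to the Euclidean norm), $i\in\mathbb{N}$, converging to the identity uniformly, such that $f_i(S)$ is a finite set for each $i\in\mathbb{N}$.
   Context: $\mathcal{H}^1$ is the $1$-dimensional Hausdorff measure. A set is $1$-rectifiable if it can be covered, up to an $\mathcal{H}^1$-null set, by countably many Lipschitz images of subsets of $\mathbb{R}$. A set $S$ is $1$-purely unrectifiable if $\mathcal{H}^1(S\cap E)=0$ for every $1$-rectifiable set $E$. *)

theory Defs
  imports "HOL-Analysis.Analysis"
begin

(* Boundedness is required explicitly because the library's diameter of an
   unbounded set is an unspecified real number. Sequences of covering sets also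
   represent finite covers, since members may be empty. *)
definition hausdorff1_pre :: "real \<Rightarrow> 'a::metric_space set \<Rightarrow> ennreal" where
  "hausdorff1_pre \<delta> E =
     Inf {(\<Sum>i. ennreal (diameter (U i))) | U :: nat \<Rightarrow> 'a set.
            E \<subseteq> (\<Union>i. U i) \<and> (\<forall>i. bounded (U i) \<and> diameter (U i) \<le> \<delta>)}"

(* Normalised so that it agrees with Lebesgue (outer) measure on the real line;
   defined on all subsets, as an outer measure. *)
definition hausdorff1 :: "'a::metric_space set \<Rightarrow> ennreal" where
  "hausdorff1 E = (SUP \<delta>\<in>{0<..}. hausdorff1_pre \<delta> E)"

(* The Lipschitz constant may depend on the index, and no measurability of E is
   assumed. *)
definition rectifiable1 :: "'a::metric_space set \<Rightarrow> bool" where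
  "rectifiable1 E \<longleftrightarrow>
     (\<exists>(A :: nat \<Rightarrow> real set) (g :: nat \<Rightarrow> real \<Rightarrow> 'a).
        (\<forall>i. \<exists>L. L-lipschitz_on (A i) (g i)) \<and>
        hausdorff1 (E - (\<Union>i. g i ` A i)) = 0)"

definition purely_unrectifiable1 :: "'a::metric_space set \<Rightarrow> bool" where
  "purely_unrectifiable1 S \<longleftrightarrow> (\<forall>E. rectifiable1 E \<longrightarrow> hausdorff1 (S \<inter> E) = 0)"

end

theory Submission
  imports Defs "HOL-Complex_Analysis.Great_Picard"
begin

text \<open>
  Fix a small \<open>\<delta> > 0\<close>. For each of the two coordinates we construct a potential \<open>w\<close> with
  \<open>0 \<le> w \<le> \<delta>\<close> whose derivative in the direction of that coordinate lies in \<open>[0, 1]\<close> and equals \<open>1\<close>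
  near \<open>S\<close>, and which is \<open>\<delta>\<close>-Lipschitz in the other coordinate. Its value at a point is the largest
  profit of a path ending there: a path earns the length of its horizontal segments inside a
  neighbourhood of \<open>S\<close> and pays \<open>\<delta>\<close> per unit of vertical motion,
  moving right being free. If the profit stayed above \<open>\<delta>\<close> for
  arbitrarily small neighbourhoods, then, the paths having bounded length, Arzela-Ascoli would give a
  Lipschitz curve whose part in \<open>S\<close> has non-null projection, against pure unrectifiability.

  Subtracting the potentials from the coordinates gives a map that is \<open>(1 + 2\<delta>)\<close>-Lipschitz and close
  to the identity, and for which each coordinate of the image of \<open>S\<close> has measure at most
  \<open>2\<delta>H\<^sup>1(S)\<close> up to an arbitrarily small error. After a
  cut-off far from \<open>S\<close> and a slight contraction it is \<open>1\<close>-Lipschitz; collapsing a small open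
  neighbourhood of the two coordinate projections makes the image of \<open>S\<close> finite.
\<close>

section \<open>Profit of paths\<close>

text \<open>
  \<open>reach U x y g c\<close>: a path ending at \<open>(x, y)\<close>, never moving left, earns \<open>g\<close> and has vertical
  variation \<open>c\<close>; its profit is \<open>g - \<delta> * c\<close>. Vertical moves are unrestricted, although only slopes
  below \<open>1 / \<delta>\<close> can pay off: this is what makes the optimal profit \<open>\<delta>\<close>-Lipschitz in \<open>y\<close>.
\<close>

inductive reach :: "(real \<times> real) set \<Rightarrow> real \<Rightarrow> real \<Rightarrow> real \<Rightarrow> real \<Rightarrow> bool"
  for U :: "(real \<times> real) set" where
  start: "reach U x y 0 0"
| gain: "reach U x y g c \<Longrightarrow> 0 \<le> s \<Longrightarrow> {x..x+s} \<times> {y} \<subseteq> U \<Longrightarrow> reach U (x + s) y (g + s) c"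
| move: "reach U x y g c \<Longrightarrow> x \<le> x' \<Longrightarrow> reach U x' y' g (c + \<bar>y' - y\<bar>)"

lemma reach_nonneg: "reach U x y g c \<Longrightarrow> 0 \<le> g \<and> 0 \<le> c"
  by (induction rule: reach.induct) auto

text \<open>Cut the path at abscissa \<open>x'\<close>: an earning segment straddling
  \<open>x'\<close> is shortened, and the vertical moves made further right are carried out on the
  line \<open>x'\<close> instead. The cost does not grow, and at most the earnings made over
  \<open>[x', x]\<close> are lost. This bounds the horizontal growth of the optimal profit.\<close>

lemma reach_truncate:
  assumes "reach U x y g c" "x' \<le> x" "0 \<le> \<delta>"
  shows "\<exists>g' c'. reach U x' y g' c' \<and> g - \<delta> * c - (x - x') \<le> g' - \<delta> * c'"
  using assms
proof (induction arbitrary: x' rule: reach.induct)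
  case (start x y)
  then show ?case by (intro exI[of _ 0]) (auto intro: reach.start)
next
  case (gain x y g c s)
  show ?case
  proof (cases "x \<le> x'")
    case True
    with gain have "reach U (x + (x' - x)) y (g + (x' - x)) c"
      by (intro reach.gain) auto
    then show ?thesis
      by (intro exI[of _ "g + (x' - x)"] exI[of _ c]) auto
  next
    case False
    with gain.IH[of x'] gain.prems show ?thesis
      by force
  qed
next
  case (move x y g c x2 y2)
  show ?case
  proof (cases "x \<le> x'")
    case True
    with move have "reach U x' y2 g (c + \<bar>y2 - y\<bar>)"
      by (intro reach.move) auto
    with move show ?thesis
      by (intro exI[of _ g] exI[of _ "c + \<bar>y2 - y\<bar>"]) auto
  next
    case False
    with move.IH[of x'] move.prems obtain g' c' where
      "reach U x' y g' c'" and *: "g - \<delta> * c - (x - x') \<le> g' - \<delta> * c'"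
      by auto
    then have "reach U x' y2 g' (c' + \<bar>y2 - y\<bar>)"
      by (intro reach.move) auto
    with * move show ?thesis
      by (intro exI[of _ g'] exI[of _ "c' + \<bar>y2 - y\<bar>"]) (auto simp: algebra_simps)
  qed
qed

section \<open>From profitable paths to Lipschitz curves\<close>

text \<open>
  Testing against open supersets avoids measurability questions for the projection; the cut at the
  endpoint makes the estimate additive when the curve is prolonged to the right.
\<close>

definition traces :: "(real \<times> real) set \<Rightarrow> real \<Rightarrow> (real \<Rightarrow> real \<times> real) \<Rightarrow> real \<Rightarrow> bool" where
  "traces U T \<Gamma> g \<longleftrightarrow>
    (\<forall>V. open V \<longrightarrow> fst ` (\<Gamma> ` {0..T} \<inter> U) \<subseteq> V \<longrightarrow> ennreal g \<le> emeasure lborel (V \<inter> {..fst (\<Gamma> T)}))"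

lemma lipschitz_extend_segment:
  fixes \<Gamma> :: "real \<Rightarrow> 'a::real_normed_vector"
  assumes "1-lipschitz_on {0..T} \<Gamma>" "0 \<le> T"
  obtains \<Gamma>' where "1-lipschitz_on {0..T + dist (\<Gamma> T) q} \<Gamma>'" "\<And>t. t \<le> T \<Longrightarrow> \<Gamma>' t = \<Gamma> t"
    "\<Gamma>' (T + dist (\<Gamma> T) q) = q"
proof (cases "q = \<Gamma> T")
  case True
  with assms that[of \<Gamma>] show ?thesis by simp
next
  case False
  define d where "d = dist (\<Gamma> T) q"
  have d: "d > 0" using False by (auto simp: d_def)
  define h where "h t = \<Gamma> T + ((t - T) / d) *\<^sub>R (q - \<Gamma> T)" for t
  have "1-lipschitz_on {T..T+d} h"
  proof (rule lipschitz_onI)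
    fix s t
    have "h s - h t = ((s - t) / d) *\<^sub>R (q - \<Gamma> T)"
      by (simp add: h_def algebra_simps diff_divide_distrib)
    then have "norm (h s - h t) = \<bar>s - t\<bar> / d * d"
      by (simp add: d_def dist_norm norm_minus_commute abs_divide)
    then show "dist (h s) (h t) \<le> 1 * dist s t"
      using d by (simp add: dist_norm)
  qed simp
  from lipschitz_on_concat[OF assms(1) this]
  have "1-lipschitz_on {0..T+d} (\<lambda>t. if t \<le> T then \<Gamma> t else h t)"
    by (simp add: h_def)
  then show ?thesis
    using that[of "\<lambda>t. if t \<le> T then \<Gamma> t else h t"] d by (simp add: d_def h_def)
qed

text \<open>The old estimate only measures \<open>V\<close> up to abscissa
  \<open>fst (\<Gamma> T) \<le> x\<close>, while the new segment, lying in \<open>U\<close>, forces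
  \<open>V\<close> to contain \<open>{x<..x+s}\<close>. These parts are disjoint, so the gains
  add.\<close>

lemma traces_extend:
  assumes tr: "traces U T \<Gamma> g" and T: "0 \<le> T" "T \<le> T1" and "0 \<le> s" "0 \<le> g"
    and eq: "\<And>t. t \<le> T \<Longrightarrow> \<Gamma>' t = \<Gamma> t"
    and new: "\<And>t. t \<in> {0..s} \<Longrightarrow> \<Gamma>' (T1 + t) = (x + t, y)"
    and le: "fst (\<Gamma> T) \<le> x" and U: "{x..x+s} \<times> {y} \<subseteq> U"
  shows "traces U (T1 + s) \<Gamma>' (g + s)"
  unfolding traces_def
proof (intro allI impI)
  fix V :: "real set" assume V: "open V" and sub: "fst ` (\<Gamma>' ` {0..T1 + s} \<inter> U) \<subseteq> V"
  have "fst ` (\<Gamma> ` {0..T} \<inter> U) \<subseteq> V"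
  proof
    fix z assume "z \<in> fst ` (\<Gamma> ` {0..T} \<inter> U)"
    then obtain t where "t \<in> {0..T}" "\<Gamma> t \<in> U" and z: "z = fst (\<Gamma> t)" by blast
    then have "\<Gamma>' t \<in> \<Gamma>' ` {0..T1 + s} \<inter> U" "\<Gamma>' t = \<Gamma> t" using eq[of t] T \<open>0 \<le> s\<close>
      by (auto intro!: image_eqI[of _ _ t])
    then show "z \<in> V" using sub z by (metis image_eqI subsetD)
  qed
  with tr V have "ennreal g \<le> emeasure lborel (V \<inter> {..fst (\<Gamma> T)})"
    by (auto simp: traces_def)
  also have "\<dots> \<le> emeasure lborel (V \<inter> {..x})"
    using V le by (intro emeasure_mono) auto
  finally have 1: "ennreal g \<le> emeasure lborel (V \<inter> {..x})" .
  have step: "x + t \<in> V" if "t \<in> {0..s}" for t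
  proof -
    have "\<Gamma>' (T1 + t) \<in> \<Gamma>' ` {0..T1 + s} \<inter> U" using new[OF that] T U that by (auto intro!: image_eqI[of _ _ "T1 + t"])
    then have "fst (\<Gamma>' (T1 + t)) \<in> V" using sub by (metis image_eqI subsetD)
    with new[OF that] show ?thesis by simp
  qed
  have stepV: "{x<..x+s} \<subseteq> V"
  proof
    fix z assume "z \<in> {x<..x+s}"
    with step[of "z - x"] show "z \<in> V" by simp
  qed
  have "ennreal (g + s) = ennreal g + emeasure lborel {x<..x+s}"
    using \<open>0 \<le> s\<close> \<open>0 \<le> g\<close> by simp
  also have "\<dots> \<le> emeasure lborel (V \<inter> {..x}) + emeasure lborel {x<..x+s}"
    using 1 by (intro add_right_mono)
  also have "\<dots> = emeasure lborel (V \<inter> {..x} \<union> {x<..x+s})"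
    using V by (intro plus_emeasure) auto
  also have "\<dots> \<le> emeasure lborel (V \<inter> {..fst (\<Gamma>' (T1 + s))})"
    using V stepV new[of s] \<open>0 \<le> s\<close> by (intro emeasure_mono) auto
  finally show "ennreal (g + s) \<le> emeasure lborel (V \<inter> {..fst (\<Gamma>' (T1 + s))})" .
qed

text \<open>The curve follows the earning segments, joined by straight lines, and stops at the end
  of the last one, hence in \<open>U\<close>; a path without earnings may never meet
  \<open>U\<close>, which is the alternative \<open>g = 0\<close>. The last inequality is the
  invariant that bounds the length: horizontal progress from \<open>-R\<close> plus vertical
  variation pays for \<open>T\<close> and for the vertical distance still to be made up.\<close>

lemma reach_curve:
  assumes "reach U x y g c" and R: "U \<subseteq> cbox (-R, -R) (R, R)"
  shows "g = 0 \<or> (\<exists>T \<Gamma>. 0 \<le> T \<and> 1-lipschitz_on {0..T} \<Gamma> \<and> \<Gamma> T \<in> U \<and> traces U T \<Gamma> g \<and>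
     fst (\<Gamma> T) \<le> x \<and> T + \<bar>y - snd (\<Gamma> T)\<bar> \<le> fst (\<Gamma> T) + R + c)"
  using assms(1)
proof (induction rule: reach.induct)
  case (start x y)
  then show ?case by simp
next
  case (move x y g c x' y')
  then show ?case by fastforce
next
  case (gain x y g c s)
  note nn = reach_nonneg[OF gain.hyps(1)]
  have xy: "(x + s, y) \<in> U" "(x, y) \<in> U" using gain by auto
  have tr0: "1-lipschitz_on {a..b} (\<lambda>t. (x + (t - k), y))" for a b k
    by (rule lipschitz_onI) (auto simp: dist_Pair_Pair dist_norm)
  show ?case
  proof (cases "g = 0")
    case True
    have "traces U s (\<lambda>t. (x + t, y)) s"
      unfolding traces_def
    proof (intro allI impI)
      fix V :: "real set" assume V: "open V" and sub: "fst ` ((\<lambda>t. (x + t, y)) ` {0..s} \<inter> U) \<subseteq> V"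
      have "{x..x+s} \<subseteq> V"
      proof
        fix z assume z: "z \<in> {x..x+s}"
        then have "(z, y) \<in> (\<lambda>t. (x + t, y)) ` {0..s} \<inter> U"
          using gain.hyps by (auto intro!: image_eqI[of _ _ "z - x"])
        then show "z \<in> V" using sub by (metis fst_conv image_eqI subsetD)
      qed
      then have "emeasure lborel {x..x+s} \<le> emeasure lborel (V \<inter> {..fst (x + s, y)})"
        using V by (intro emeasure_mono) auto
      then show "ennreal s \<le> emeasure lborel (V \<inter> {..fst (x + s, y)})"
        using gain by simp
    qed
    moreover have "- R \<le> x" using xy R by auto
    ultimately show ?thesis
      using True gain.hyps xy nn tr0[of 0 s 0] by (intro disjI2 exI[of _ s] exI[of _ "\<lambda>t. (x + t, y)"]) auto
  next
    case False
    with gain.IH obtain T \<Gamma> where T: "0 \<le> T" "1-lipschitz_on {0..T} \<Gamma>" "\<Gamma> T \<in> U" "traces U T \<Gamma> g"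
      "fst (\<Gamma> T) \<le> x" "T + \<bar>y - snd (\<Gamma> T)\<bar> \<le> fst (\<Gamma> T) + R + c"
      by blast
    \<comment> \<open>A straight line to \<open>(x, y)\<close> replaces the moves made since the
      last earning segment. Its length is at most the sum of the horizontal and vertical
      displacements, which the invariant has already set aside.\<close>
    define T1 where "T1 = T + dist (\<Gamma> T) (x, y)"
    obtain \<Gamma>' where \<Gamma>': "1-lipschitz_on {0..T1} \<Gamma>'" "\<And>t. t \<le> T \<Longrightarrow> \<Gamma>' t = \<Gamma> t" "\<Gamma>' T1 = (x, y)"
      using lipschitz_extend_segment[OF T(2,1), of "(x,y)"] unfolding T1_def by blast
    have T1: "T \<le> T1" by (simp add: T1_def)
    have "dist (\<Gamma> T) (x, y) \<le> \<bar>x - fst (\<Gamma> T)\<bar> + \<bar>y - snd (\<Gamma> T)\<bar>"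
      by (cases "\<Gamma> T") (simp add: dist_Pair_Pair dist_real_def sqrt_sum_squares_le_sum_abs abs_minus_commute)
    then have le: "T1 \<le> x + R + c" using T by (simp add: T1_def)
    define G where "G t = (if t \<le> T1 then \<Gamma>' t else (x + (t - T1), y))" for t
    have "1-lipschitz_on {0..T1+s} G"
      unfolding G_def by (rule lipschitz_on_concat[OF \<Gamma>'(1) tr0]) (simp add: \<Gamma>')
    moreover have G: "G (T1 + t) = (x + t, y)" if "t \<in> {0..s}" for t
      using that \<Gamma>' by (cases "t = 0") (auto simp: G_def)
    moreover have "traces U (T1 + s) G (g + s)"
      using T1 \<Gamma>' by (intro traces_extend[OF T(4) T(1) T1 gain.hyps(2) _ _ G T(5) gain.hyps(3)]) (auto simp: G_def nn)
    ultimately show ?thesis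
      using le T1 T(1) gain.hyps xy by (intro disjI2 exI[of _ "T1 + s"] exI[of _ G]) auto
  qed
qed

section \<open>Potentials\<close>

text \<open>Traces in shrinking neighbourhoods are upper semicontinuous: an open \<open>V\<close>
  containing the projection of the part of the limit curve in \<open>S\<close> also contains the
  projection of the part in \<open>U n\<close> of some approximating curve. As that projection is
  null, \<open>V\<close> can be chosen of measure below \<open>\<epsilon>\<close>, contradicting
  gains above \<open>\<epsilon>\<close>.\<close>

lemma width_nbhd:
  fixes S :: "(real \<times> real) set"
  assumes S: "compact S" and "0 < \<delta>" "0 < \<epsilon>"
    and null: "\<And>a b :: real \<Rightarrow> real. 1-lipschitz_on UNIV a \<Longrightarrow> 1-lipschitz_on UNIV b \<Longrightarrow> negligible {a t |t. (a t, b t) \<in> S}"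
  obtains r where "0 < r" "\<And>x y g c. reach (\<Union>q\<in>S. ball q r) x y g c \<Longrightarrow> g - \<delta> * c \<le> \<epsilon>"
proof (rule ccontr)
  assume contra: "\<not> thesis"
  define U where "U n = (\<Union>q\<in>S. ball q (1 / real (Suc n)))" for n
  have "\<exists>x y g c. reach (U n) x y g c \<and> \<epsilon> < g - \<delta> * c" for n
  proof (rule ccontr)
    assume "\<nexists>x y g c. reach (U n) x y g c \<and> \<epsilon> < g - \<delta> * c"
    then have "thesis"
      by (intro that[of "1 / real (Suc n)"]) (auto simp: U_def not_less)
    with contra show False by simp
  qed
  then obtain x y g c where reach: "\<And>n. reach (U n) (x n) (y n) (g n) (c n)"
    and gain: "\<And>n. \<epsilon> < g n - \<delta> * c n"
    by metis
  obtain B where B: "\<And>p. p \<in> S \<Longrightarrow> norm p \<le> B"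
    using compact_imp_bounded[OF S] by (auto simp: bounded_iff)
  define R where "R = \<bar>B\<bar> + 1"
  have R: "norm p \<le> R" if p: "p \<in> U n" for p n
  proof -
    obtain q where q: "q \<in> S" "dist q p < 1 / real (Suc n)"
      using p unfolding U_def UN_iff mem_ball by blast
    have "norm p \<le> norm q + dist q p"
      by (metis dist_0_norm dist_triangle)
    also have "\<dots> \<le> B + 1"
    proof (intro add_mono)
      have "1 / real (Suc n) \<le> 1" by simp
      then show "dist q p \<le> 1" using q by linarith
    qed (use B q in blast)
    finally show ?thesis by (simp add: R_def)
  qed
  have R0: "R \<ge> 0" by (simp add: R_def)
  have fstR: "\<bar>fst p\<bar> \<le> R" if "p \<in> U n" for p n
    using R[OF that] norm_fst_le[of "fst p" "snd p"] by simp
  have cbox: "U n \<subseteq> cbox (-R, -R) (R, R)" for n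
  proof
    fix p assume "p \<in> U n"
    then have "\<bar>fst p\<bar> \<le> R" "\<bar>snd p\<bar> \<le> R"
      using fstR R[of p n] norm_snd_le[of "snd p" "fst p"] by auto
    then show "p \<in> cbox (-R, -R) (R, R)" by (cases p) auto
  qed
  have gpos: "g n \<noteq> 0" for n
    using gain[of n] reach_nonneg[OF reach[of n]] \<open>0 < \<delta>\<close> \<open>0 < \<epsilon>\<close>
    by (smt (verit) mult_nonneg_nonneg)
  have "\<exists>T \<Gamma>. 0 \<le> T \<and> 1-lipschitz_on {0..T} \<Gamma> \<and> \<Gamma> T \<in> U n \<and> traces (U n) T \<Gamma> (g n) \<and>
     fst (\<Gamma> T) \<le> x n \<and> T + \<bar>y n - snd (\<Gamma> T)\<bar> \<le> fst (\<Gamma> T) + R + c n" for n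
    using reach_curve[OF reach cbox, of n] gpos[of n] by simp
  then obtain T \<Gamma> where T0: "\<And>n. 0 \<le> T n" and lip: "\<And>n. 1-lipschitz_on {0..T n} (\<Gamma> n)"
    and endU: "\<And>n. \<Gamma> n (T n) \<in> U n" and tr: "\<And>n. traces (U n) (T n) (\<Gamma> n) (g n)"
    and T: "\<And>n. T n + \<bar>y n - snd (\<Gamma> n (T n))\<bar> \<le> fst (\<Gamma> n (T n)) + R + c n"
    by metis
  \<comment> \<open>The gain is at most \<open>2 * R + 2\<close>, the width of an interval
    containing the projection of \<open>U n\<close>. Positive profit then bounds the vertical cost
    by \<open>(2 * R + 2) / \<delta>\<close>, and horizontal progress from \<open>-R\<close> is at
    most \<open>2 * R\<close>.\<close>
  define L where "L = 2 * R + (2 * R + 2) / \<delta>"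
  have TL: "T n \<le> L" for n
  proof -
    have "fst ` (\<Gamma> n ` {0..T n} \<inter> U n) \<subseteq> {-R-1<..<R+1}"
      by (auto dest!: fstR simp: abs_le_iff)
    then have "ennreal (g n) \<le> emeasure lborel ({-R-1<..<R+1} \<inter> {..fst (\<Gamma> n (T n))})"
      by (intro tr[unfolded traces_def, rule_format]) auto
    also have "\<dots> \<le> emeasure lborel {-R-1<..<R+1}" by (intro emeasure_mono) auto
    also have "\<dots> = ennreal (2 * R + 2)" using R0 by simp
    finally have "g n \<le> 2 * R + 2" using R0 by (subst (asm) ennreal_le_iff) auto
    then have "\<delta> * c n \<le> 2 * R + 2" using gain[of n] \<open>0 < \<epsilon>\<close> by simp
    then have "c n \<le> (2 * R + 2) / \<delta>" using \<open>0 < \<delta>\<close> by (simp add: field_simps)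
    moreover have "fst (\<Gamma> n (T n)) \<le> R"
      using fstR[OF endU[of n]] by simp
    ultimately show ?thesis using T[of n] by (auto simp: L_def)
  qed
  have L0: "0 \<le> L" using T0[of 0] TL[of 0] by simp
  \<comment> \<open>Freezing each curve at its endpoint gives all of them the common domain
    \<open>{0..L}\<close>, as Arzela-Ascoli requires.\<close>
  define F where "F n t = \<Gamma> n (min t (T n))" for n t
  have F_lip: "norm (F n s - F n t) \<le> \<bar>s - t\<bar>" if "s \<ge> 0" "t \<ge> 0" for n s t
  proof -
    have "norm (F n s - F n t) \<le> 1 * dist (min s (T n)) (min t (T n))"
      using lipschitz_onD[OF lip[of n], of "min s (T n)" "min t (T n)"] that T0[of n]
      by (simp add: F_def dist_norm)
    also have "\<dots> \<le> \<bar>s - t\<bar>" by (simp add: dist_real_def)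
    finally show ?thesis .
  qed
  have F_bd: "norm (F n t) \<le> R + L" if "t \<in> {0..L}" for n t
  proof -
    have "norm (F n t) \<le> norm (F n (T n)) + norm (F n t - F n (T n))"
      by (metis norm_triangle_sub)
    also have "\<dots> \<le> R + \<bar>t - T n\<bar>"
      using F_lip[of t "T n" n] that T0[of n] R[OF endU[of n]] by (intro add_mono) (auto simp: F_def)
    also have "\<dots> \<le> R + L" using that T0[of n] TL[of n] by auto
    finally show ?thesis .
  qed
  obtain G k where G: "continuous_on {0..L} G" and k: "strict_mono (k :: nat \<Rightarrow> nat)"
    and lim: "\<And>e. 0 < e \<Longrightarrow> \<exists>N. \<forall>n t. n \<ge> N \<and> t \<in> {0..L} \<longrightarrow> norm (F (k n) t - G t) < e"
  proof (rule Arzela_Ascoli[of "{0..L}" F "R + L"])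
    show "\<exists>d>0. \<forall>n u. u \<in> {0..L} \<and> norm (t - u) < d \<longrightarrow> norm (F n t - F n u) < e"
      if t: "t \<in> {0..L}" "0 < e" for t e
    proof (intro exI[of _ e] conjI allI impI)
      fix n u assume "u \<in> {0..L} \<and> norm (t - u) < e"
      then show "norm (F n t - F n u) < e" using F_lip[of t u n] t by simp
    qed (use t in simp)
  qed (use F_bd in auto)
  have limF: "(\<lambda>n. F (k n) t) \<longlonglongrightarrow> G t" if "t \<in> {0..L}" for t
    unfolding LIMSEQ_iff using lim that by blast
  have G_lip: "dist (G s) (G t) \<le> \<bar>s - t\<bar>" if "s \<in> {0..L}" "t \<in> {0..L}" for s t
  proof (rule LIMSEQ_le_const2)
    show "(\<lambda>n. dist (F (k n) s) (F (k n) t)) \<longlonglongrightarrow> dist (G s) (G t)"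
      using that by (intro tendsto_intros limF)
    show "\<exists>N. \<forall>n\<ge>N. dist (F (k n) s) (F (k n) t) \<le> \<bar>s - t\<bar>"
      using F_lip that by (auto simp: dist_norm)
  qed
  \<comment> \<open>Clamping the parameter extends the limit to the whole line, where
    \<open>null\<close> applies.\<close>
  define H where "H t = G (max 0 (min L t))" for t
  have H_lip: "dist (H s) (H t) \<le> 1 * dist s t" for s t
  proof -
    have "dist (H s) (H t) \<le> \<bar>max 0 (min L s) - max 0 (min L t)\<bar>"
      unfolding H_def using L0 by (intro G_lip) auto
    also have "\<dots> \<le> \<bar>s - t\<bar>" by auto
    finally show ?thesis by (simp add: dist_real_def)
  qed
  define N where "N = {fst (H t) |t. (fst (H t), snd (H t)) \<in> S}"
  have "negligible N"
    unfolding N_def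
  proof (rule null[of "\<lambda>t. fst (H t)" "\<lambda>t. snd (H t)"])
    show "1-lipschitz_on UNIV (\<lambda>t. fst (H t))" "1-lipschitz_on UNIV (\<lambda>t. snd (H t))"
      by (auto intro!: lipschitz_onI order_trans[OF dist_fst_le] order_trans[OF dist_snd_le] H_lip[simplified])
  qed
  then have N: "N \<in> null_sets lebesgue" by (simp add: negligible_iff_null_sets)
  obtain V where V: "open V" "N \<subseteq> V" "emeasure lebesgue (V - N) < ennreal \<epsilon>"
    using sets_lebesgue_outer_open[OF null_setsD2[OF N] \<open>0 < \<epsilon>\<close>] by blast
  have "emeasure lborel V = emeasure lebesgue (V - N)"
    using V N by (simp add: emeasure_Diff_null_set)
  with V have Vlt: "emeasure lborel V < ennreal \<epsilon>" by simp
  \<comment> \<open>Otherwise each curve has a point of \<open>U (k n)\<close> projecting outside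
    \<open>V\<close>. A subsequence of these points converges to a point \<open>G u\<close> of the
    limit curve; being ever closer to \<open>S\<close>, they force \<open>G u\<close> into
    \<open>S\<close>, so \<open>fst (G u)\<close> lies in \<open>N\<close> and hence in the open set
    \<open>V\<close>, a contradiction.\<close>
  have "\<exists>n. fst ` (\<Gamma> (k n) ` {0..T (k n)} \<inter> U (k n)) \<subseteq> V"
  proof (rule ccontr)
    assume "\<not> ?thesis"
    then have "\<exists>t. t \<in> {0..T (k n)} \<and> \<Gamma> (k n) t \<in> U (k n) \<and> fst (\<Gamma> (k n) t) \<notin> V" for n
      by blast
    then obtain t where t: "\<And>n. t n \<in> {0..T (k n)}" "\<And>n. \<Gamma> (k n) (t n) \<in> U (k n)"
      "\<And>n. fst (\<Gamma> (k n) (t n)) \<notin> V" by metis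
    have tF: "F (k n) (t n) = \<Gamma> (k n) (t n)" for n using t(1)[of n] by (simp add: F_def min_absorb1)
    have tL: "t n \<in> {0..L}" for n using t(1)[of n] TL[of "k n"] by simp
    have "compact {0..L}" by simp
    with tL obtain u m where u: "u \<in> {0..L}" and m: "strict_mono (m :: nat \<Rightarrow> nat)" and tu: "(t \<circ> m) \<longlonglongrightarrow> u"
      unfolding compact_def by metis
    define P where "P n = F (k (m n)) (t (m n))" for n
    have "(\<lambda>n. F (k (m n)) u) \<longlonglongrightarrow> G u"
      using LIMSEQ_subseq_LIMSEQ[OF limF[OF u] m] by (simp add: o_def)
    moreover have "(\<lambda>n. P n - F (k (m n)) u) \<longlonglongrightarrow> 0"
    proof (rule Lim_null_comparison)
      show "\<forall>\<^sub>F n in sequentially. norm (P n - F (k (m n)) u) \<le> \<bar>t (m n) - u\<bar>"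
        using F_lip tL u by (auto simp: P_def)
      have "(\<lambda>n. \<bar>t (m n) - u\<bar>) \<longlonglongrightarrow> \<bar>u - u\<bar>"
        using tu by (intro tendsto_intros) (simp add: o_def)
      then show "(\<lambda>n. \<bar>t (m n) - u\<bar>) \<longlonglongrightarrow> 0" by simp
    qed
    ultimately have P: "P \<longlonglongrightarrow> G u" using Lim_transform by blast
    have "\<exists>q\<in>S. dist q (P n) < 1 / real (Suc (k (m n)))" for n
      using t(2)[of "m n"] tF[of "m n"] by (auto simp: P_def U_def)
    then obtain q where q: "\<And>n. q n \<in> S" "\<And>n. dist (q n) (P n) < 1 / real (Suc (k (m n)))" by metis
    have "(\<lambda>n. q n - P n) \<longlonglongrightarrow> 0"
    proof (rule Lim_null_comparison)
      show "\<forall>\<^sub>F n in sequentially. norm (q n - P n) \<le> 1 / real (Suc (k (m n)))"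
        by (intro always_eventually allI less_imp_le q(2)[unfolded dist_norm])
      have "strict_mono (\<lambda>n. k (m n))" using k m by (auto simp: strict_mono_def)
      then show "(\<lambda>n. 1 / real (Suc (k (m n)))) \<longlonglongrightarrow> 0"
        using LIMSEQ_subseq_LIMSEQ[OF LIMSEQ_inverse_real_of_nat] by (fastforce simp: o_def inverse_eq_divide)
    qed
    then have "q \<longlonglongrightarrow> G u" using P Lim_transform by blast
    then have "G u \<in> S" using closed_sequentially[OF compact_imp_closed[OF S]] q(1) by blast
    then have "fst (G u) \<in> V" using V u unfolding N_def H_def
      by (auto simp: subset_iff intro!: exI[of _ u])
    then have "\<forall>\<^sub>F n in sequentially. fst (P n) \<in> V"
      using topological_tendstoD[OF tendsto_fst[OF P] V(1)] by simp
    then obtain n where "fst (P n) \<in> V" by (auto simp: eventually_sequentially)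
    then show False using t(3)[of "m n"] tF[of "m n"] by (simp add: P_def)
  qed
  then obtain n where n: "fst ` (\<Gamma> (k n) ` {0..T (k n)} \<inter> U (k n)) \<subseteq> V" ..
  have "ennreal (g (k n)) \<le> emeasure lborel (V \<inter> {..fst (\<Gamma> (k n) (T (k n)))})"
    by (intro tr[unfolded traces_def, rule_format] V(1) n)
  also have "\<dots> \<le> emeasure lborel V" using V(1) by (intro emeasure_mono) auto
  finally have "ennreal (g (k n)) < ennreal \<epsilon>" using Vlt by simp
  then have "g (k n) < \<epsilon>" using reach_nonneg[OF reach[of "k n"]] by (simp add: ennreal_less_iff)
  with gain[of "k n"] reach_nonneg[OF reach[of "k n"]] \<open>0 < \<delta>\<close> show False
    by (smt (verit) mult_nonneg_nonneg)
qed

text \<open>\<open>w\<close> is the supremum of the profits of paths ending at the given point. Each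
  property comes from an operation on paths: the trivial path, moving right for free, truncation, a
  vertical move at price \<open>\<delta>\<close> per unit, and an earning segment. The upper bound
  is \<open>width_nbhd\<close>.\<close>

lemma exists_potential:
  fixes S :: "(real \<times> real) set"
  assumes S: "compact S" and "0 < \<delta>" "0 < \<epsilon>"
    and null: "\<And>a b :: real \<Rightarrow> real. 1-lipschitz_on UNIV a \<Longrightarrow> 1-lipschitz_on UNIV b \<Longrightarrow> negligible {a t |t. (a t, b t) \<in> S}"
  obtains r w where "0 < r" "\<And>x y. 0 \<le> w x y" "\<And>x y. w x y \<le> \<epsilon>"
    "\<And>x x' y. x \<le> x' \<Longrightarrow> w x y \<le> w x' y"
    "\<And>x x' y. x \<le> x' \<Longrightarrow> w x' y \<le> w x y + (x' - x)"
    "\<And>x y y'. \<bar>w x y - w x y'\<bar> \<le> \<delta> * \<bar>y - y'\<bar>"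
    "\<And>x x' y. x \<le> x' \<Longrightarrow> {x..x'} \<times> {y} \<subseteq> (\<Union>q\<in>S. ball q r) \<Longrightarrow> w x y + (x' - x) \<le> w x' y"
proof -
  obtain r where "0 < r" and bd: "\<And>x y g c. reach (\<Union>q\<in>S. ball q r) x y g c \<Longrightarrow> g - \<delta> * c \<le> \<epsilon>"
    using width_nbhd[OF assms] by blast
  define U where "U = (\<Union>q\<in>S. ball q r)"
  define A where "A x y = {g - \<delta> * c |g c. reach U x y g c}" for x y
  define w where "w x y = Sup (A x y)" for x y
  have bdd: "bdd_above (A x y)" for x y
    using bd by (force simp: A_def U_def bdd_above_def)
  have upper: "g - \<delta> * c \<le> w x y" if "reach U x y g c" for x y g c
    unfolding w_def using that by (intro cSup_upper bdd) (auto simp: A_def)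
  have least: "w x y \<le> M" if "\<And>g c. reach U x y g c \<Longrightarrow> g - \<delta> * c \<le> M" for x y M
    unfolding w_def
  proof (rule cSup_least)
    show "A x y \<noteq> {}" using reach.start[of U x y] by (auto simp: A_def)
  qed (use that in \<open>auto simp: A_def\<close>)
  have vert: "w x y \<le> w x y' + \<delta> * \<bar>y - y'\<bar>" for x y y'
  proof (rule least)
    fix g c assume "reach U x y g c"
    from upper[OF reach.move[OF this, of x y']] show "g - \<delta> * c \<le> w x y' + \<delta> * \<bar>y - y'\<bar>"
      by (simp add: algebra_simps abs_minus_commute)
  qed
  show ?thesis
  proof (rule that[OF \<open>0 < r\<close>, of w])
    fix x x' y :: real
    show "0 \<le> w x y" using upper[OF reach.start] by simp
    show "w x y \<le> \<epsilon>" using bd by (intro least) (auto simp: U_def)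
    assume le: "x \<le> x'"
    show "w x y \<le> w x' y"
    proof (rule least)
      fix g c assume "reach U x y g c"
      from upper[OF reach.move[OF this le, of y]] show "g - \<delta> * c \<le> w x' y" by simp
    qed
    show "w x' y \<le> w x y + (x' - x)"
    proof (rule least)
      fix g c assume "reach U x' y g c"
      from reach_truncate[OF this le, of \<delta>] \<open>0 < \<delta>\<close> obtain g' c' where
        "reach U x y g' c'" "g - \<delta> * c - (x' - x) \<le> g' - \<delta> * c'" by auto
      with upper[OF this(1)] show "g - \<delta> * c \<le> w x y + (x' - x)" by simp
    qed
    assume seg: "{x..x'} \<times> {y} \<subseteq> (\<Union>q\<in>S. ball q r)"
    have "w x y \<le> w x' y - (x' - x)"
    proof (rule least)
      fix g c assume "reach U x y g c"
      from upper[OF reach.gain[OF this, of "x' - x"]] le seg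
      show "g - \<delta> * c \<le> w x' y - (x' - x)" by (simp add: U_def)
    qed
    then show "w x y + (x' - x) \<le> w x' y" by simp
  next
    fix x y y'
    show "\<bar>w x y - w x y'\<bar> \<le> \<delta> * \<bar>y - y'\<bar>"
      using vert[of x y y'] vert[of x y' y] by (simp add: abs_minus_commute abs_le_iff)
  qed
qed

section \<open>Coverings and null projections\<close>

text \<open>Each piece \<open>E \<inter> U i\<close> maps into the interval of radius
  \<open>c * diameter (U i)\<close> about the image of one of its points, whence the factor 2. The
  Lipschitz bound is needed only within single pieces, so a map that is flat merely at small scales
  qualifies.\<close>

lemma image_cover_outer:
  fixes h :: "'a::metric_space \<Rightarrow> real"
  assumes bd: "\<And>i. bounded (U i)" and sub: "E \<subseteq> (\<Union>i. U i)" and "0 \<le> c"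
    and h: "\<And>i p q. p \<in> E \<inter> U i \<Longrightarrow> q \<in> E \<inter> U i \<Longrightarrow> \<bar>h p - h q\<bar> \<le> c * dist p q"
  obtains T where "T \<in> sets lborel" "h ` E \<subseteq> T"
    "emeasure lborel T \<le> ennreal (2 * c) * (\<Sum>i. ennreal (diameter (U i)))"
proof -
  \<comment> \<open>For an empty piece \<open>p i\<close> is arbitrary; the resulting interval
    covers nothing needed but obeys the same length bound.\<close>
  define p where "p i = (SOME p. p \<in> E \<inter> U i)" for i :: nat
  define d where "d i = c * diameter (U i)" for i
  have d0: "0 \<le> d i" for i using diameter_ge_0[OF bd] \<open>0 \<le> c\<close> by (simp add: d_def)
  define J where "J i = {h (p i) - d i..h (p i) + d i}" for i
  have "h ` E \<subseteq> (\<Union>i. J i)"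
  proof
    fix z assume "z \<in> h ` E"
    then obtain q i where q: "z = h q" "q \<in> E \<inter> U i" using sub by blast
    then have p: "p i \<in> E \<inter> U i" unfolding p_def by (metis someI)
    have "\<bar>h q - h (p i)\<bar> \<le> c * dist q (p i)" using h q p by blast
    also have "\<dots> \<le> d i"
      unfolding d_def using q p bd \<open>0 \<le> c\<close> by (intro mult_left_mono diameter_bounded_bound) auto
    finally show "z \<in> (\<Union>i. J i)" using q by (auto simp: J_def abs_le_iff intro!: exI[of _ i])
  qed
  moreover have "emeasure lborel (\<Union>i. J i) \<le> (\<Sum>i. emeasure lborel (J i))"
    by (intro emeasure_subadditive_countably) (auto simp: J_def)
  moreover have "(\<Sum>i. emeasure lborel (J i)) = ennreal (2 * c) * (\<Sum>i. ennreal (diameter (U i)))"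
  proof -
    have "emeasure lborel (J i) = ennreal (2 * c) * ennreal (diameter (U i))" for i
    proof -
      have "emeasure lborel (J i) = ennreal (2 * c * diameter (U i))"
        using d0[of i] by (simp add: J_def) (simp add: d_def algebra_simps)
      then show ?thesis using \<open>0 \<le> c\<close> diameter_ge_0[OF bd] by (simp add: ennreal_mult del: ennreal_mult')
    qed
    then show ?thesis by simp
  qed
  ultimately show ?thesis
    using that[of "\<Union>i. J i"] by (auto simp: J_def)
qed

lemma hausdorff1_pre_cover:
  assumes "hausdorff1 S < ennreal H" "0 < \<eta>"
  obtains U where "S \<subseteq> (\<Union>i. U i)" "\<And>i. bounded (U i)" "\<And>i. diameter (U i) \<le> \<eta>"
    "(\<Sum>i. ennreal (diameter (U i))) < ennreal H"
proof -
  have "hausdorff1_pre \<eta> S \<le> hausdorff1 S"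
    unfolding hausdorff1_def using assms by (intro SUP_upper) auto
  then have "hausdorff1_pre \<eta> S < ennreal H" using assms by simp
  then show ?thesis
    unfolding hausdorff1_pre_def Inf_less_iff using that by blast
qed

lemma negligible_image_hausdorff1_null:
  fixes h :: "'a::metric_space \<Rightarrow> real"
  assumes "hausdorff1 E = 0" "1-lipschitz_on UNIV h"
  shows "negligible (h ` E)"
  unfolding negligible_outer_le
proof (intro allI impI)
  fix e :: real assume e: "e > 0"
  then have "hausdorff1 E < ennreal (e / 2)" using assms by simp
  from hausdorff1_pre_cover[OF this zero_less_one] obtain U where
    U: "E \<subseteq> (\<Union>i. U i)" "\<And>i. bounded (U i)" "(\<Sum>i. ennreal (diameter (U i))) < ennreal (e / 2)" by metis
  have "\<bar>h p - h q\<bar> \<le> 1 * dist p q" for p q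
    using lipschitz_onD[OF assms(2), of p q] by (simp add: dist_real_def)
  with image_cover_outer[OF U(2,1), of 1 h] obtain T where
    T: "T \<in> sets lborel" "h ` E \<subseteq> T" "emeasure lborel T \<le> ennreal 2 * (\<Sum>i. ennreal (diameter (U i)))"
    by auto
  note T(3)
  also have "ennreal 2 * (\<Sum>i. ennreal (diameter (U i))) \<le> ennreal 2 * ennreal (e / 2)"
    using U(3) by (intro mult_left_mono) auto
  also have "\<dots> = ennreal (2 * (e / 2))" using e by (intro ennreal_mult[symmetric]) auto
  finally have le: "emeasure lebesgue T \<le> ennreal e" using T(1) by simp
  moreover have "T \<in> lmeasurable"
    using T(1) le by (auto simp: fmeasurable_def top.not_eq_extremum[symmetric] less_top[symmetric] top_unique)
  ultimately show "\<exists>T. h ` E \<subseteq> T \<and> T \<in> lmeasurable \<and> measure lebesgue T \<le> e"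
    using T(2) e by (intro exI[of _ T]) (simp add: emeasure_eq_measure2)
qed

section \<open>Collapsing compact sets of small measure\<close>

text \<open>Squeeze to zero length an open \<open>V\<close> containing \<open>K\<close> of measure
  at most \<open>\<sigma>\<close>, by subtracting from \<open>t\<close> the measure of
  \<open>V\<close> to its left. No point moves by more than the measure of \<open>V\<close>, and
  local constancy near the compact \<open>K\<close> leaves finitely many values.\<close>

lemma collapse_compact:
  fixes K :: "real set"
  assumes K: "compact K" and small: "emeasure lborel K < ennreal \<sigma>"
  obtains g where "\<And>s t. \<bar>g s - g t\<bar> \<le> \<bar>s - t\<bar>" "\<And>t. \<bar>g t - t\<bar> \<le> \<sigma>" "finite (g ` K)"
proof -
  have Kb: "K \<in> sets borel" using K by (simp add: borel_compact)
  obtain s where s: "emeasure lborel K = ennreal s" "0 \<le> s" "s < \<sigma>"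
    using small by (cases "emeasure lborel K") (auto simp: ennreal_less_iff)
  obtain V where V: "open V" "K \<subseteq> V" "emeasure lborel (V - K) < ennreal (\<sigma> - s)"
    using outer_regular_lborel[OF Kb, of "\<sigma> - s"] s by auto
  have "emeasure lborel V = emeasure lborel (V - K) + emeasure lborel K"
    using V Kb by (subst plus_emeasure) (auto simp: Un_absorb2)
  also have "\<dots> \<le> ennreal (\<sigma> - s) + ennreal s"
    using V s by (intro add_mono) auto
  also have "\<dots> = ennreal \<sigma>" using s by (simp flip: ennreal_plus)
  finally have V\<sigma>: "emeasure lborel V \<le> ennreal \<sigma>" .
  have fin: "emeasure lborel A < \<infinity>" if "A \<subseteq> V" for A
  proof -
    have "emeasure lborel A \<le> emeasure lborel V"
      using that V by (intro emeasure_mono) auto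
    also have "\<dots> < \<infinity>" using V\<sigma> by (simp add: le_less_trans[OF _ ennreal_less_top])
    finally show ?thesis .
  qed
  define m where "m A = measure lborel (V \<inter> A)" for A
  \<comment> \<open>\<open>g\<close> has slope \<open>0\<close> on \<open>V\<close>, hence is locally constant near \<open>K\<close>, and slope \<open>1\<close> elsewhere.\<close>
  define g where "g t = t - m {..t}" for t
  have m_le: "m A \<le> \<sigma>" if "A \<in> sets borel" for A
  proof -
    have "emeasure lborel (V \<inter> A) \<le> ennreal \<sigma>"
      using V\<sigma> V that by (intro order_trans[OF emeasure_mono V\<sigma>]) auto
    then show ?thesis unfolding m_def measure_def using s by (simp add: enn2real_leI)
  qed
  have g_diff: "g t - g s = (t - s) - m {s<..t}" if "s \<le> t" for s t
  proof -
    have "measure lborel (V \<inter> {..s} \<union> V \<inter> {s<..t}) = m {..s} + m {s<..t}"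
      unfolding m_def using V fin[of "V \<inter> {..s}"] fin[of "V \<inter> {s<..t}"]
      by (intro measure_Union) auto
    moreover have "V \<inter> {..s} \<union> V \<inter> {s<..t} = V \<inter> {..t}" using that by auto
    ultimately show ?thesis by (simp add: g_def m_def)
  qed
  have m_seg: "0 \<le> m {s<..t}" "m {s<..t} \<le> t - s" if "s \<le> t" for s t
  proof -
    show "0 \<le> m {s<..t}" by (simp add: m_def)
    have "m {s<..t} \<le> measure lborel {s<..t}"
      unfolding m_def using V that by (intro measure_mono_fmeasurable) (auto simp: fmeasurable_def)
    then show "m {s<..t} \<le> t - s" using that by simp
  qed
  have lip: "\<bar>g t - g s\<bar> \<le> \<bar>t - s\<bar>" if "s \<le> t" for s t
    using g_diff[OF that] m_seg[OF that] by simp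
  have const: "g t = g s" if "s \<le> t" "{s<..t} \<subseteq> V" for s t
  proof -
    have "m {s<..t} = t - s" using that by (simp add: m_def Int_absorb1)
    with g_diff[OF that(1)] show ?thesis by simp
  qed
  have "\<exists>e>0. ball x e \<subseteq> V" if "x \<in> K" for x
    using V that by (auto simp: open_contains_ball subset_iff)
  then obtain e where e: "\<And>x. x \<in> K \<Longrightarrow> 0 < e x \<and> ball x (e x) \<subseteq> V" by metis
  have gconst: "g y = g x" if "x \<in> K" "y \<in> ball x (e x)" for x y
  proof (cases "x \<le> y")
    case True
    have "{x<..y} \<subseteq> ball x (e x)" using that by (auto simp: dist_real_def)
    then show ?thesis using const[OF True] e[OF that(1)] by blast
  next
    case False
    have "{y<..x} \<subseteq> ball x (e x)" using that e[OF that(1)] by (auto simp: dist_real_def)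
    then show ?thesis using const[of y x] False e[OF that(1)] by force
  qed
  obtain D where D: "D \<subseteq> K" "finite D" "K \<subseteq> (\<Union>x\<in>D. ball x (e x))"
  proof (rule compactE_image[OF K, of K "\<lambda>x. ball x (e x)"])
    show "K \<subseteq> (\<Union>x\<in>K. ball x (e x))" using e by force
  qed auto
  have "g ` K \<subseteq> g ` D"
    using D gconst by blast
  then have "finite (g ` K)" using D(2) finite_subset by blast
  moreover have "\<bar>g s - g t\<bar> \<le> \<bar>s - t\<bar>" for s t
    using lip[of s t] lip[of t s] by linarith
  moreover have "\<bar>g t - t\<bar> \<le> \<sigma>" for t
    using m_le[of "{..t}"] by (simp add: g_def m_def)
  ultimately show ?thesis using that by blast
qed

section \<open>Maps of the plane\<close>

definition other :: "2 \<Rightarrow> 2" where "other i = (if i = 1 then 2 else 1)"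

lemma UNIV_other: "UNIV = {i, other i}" and other_neq: "other i \<noteq> i"
  using exhaust_2[of i] by (auto simp: other_def UNIV_2)

lemma norm_le_other:
  fixes u :: "real ^ 2"
  shows "norm u \<le> \<bar>u $ i\<bar> + \<bar>u $ other i\<bar>"
  using norm_le_l1_cart[of u] other_neq[of i] by (simp add: UNIV_other[of i])

text \<open>Interchanging the two coordinates preserves the norm, so \<open>v\<close> is dominated
  componentwise by a combination of two vectors \<open>a\<close> and \<open>b\<close> that both have
  norm \<open>norm u\<close>.\<close>

lemma norm_le_of_components:
  fixes u v :: "real ^ 2"
  assumes "\<And>i. \<bar>v $ i\<bar> \<le> \<alpha> * \<bar>u $ i\<bar> + \<beta> * \<bar>u $ other i\<bar>" "0 \<le> \<alpha>" "0 \<le> \<beta>"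
  shows "norm v \<le> (\<alpha> + \<beta>) * norm u"
proof -
  define a b :: "real ^ 2" where "a = (\<chi> k. \<bar>u $ k\<bar>)" and "b = (\<chi> k. \<bar>u $ other k\<bar>)"
  have eq: "norm a = norm u" "norm b = norm u"
    by (simp_all add: a_def b_def norm_vec_def L2_set_def sum_2 other_def add.commute)
  have "norm v \<le> norm (\<alpha> *\<^sub>R a + \<beta> *\<^sub>R b)"
    using assms by (intro norm_le_componentwise_cart) (simp add: a_def b_def abs_of_nonneg)
  also have "\<dots> \<le> norm (\<alpha> *\<^sub>R a) + norm (\<beta> *\<^sub>R b)"
    by (rule norm_triangle_ineq)
  also have "\<dots> = (\<alpha> + \<beta>) * norm u"
    using assms by (simp add: eq algebra_simps)
  finally show ?thesis .
qed

lemma hausdorff1_empty: "hausdorff1 ({} :: 'a::metric_space set) = 0"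
proof -
  have "hausdorff1_pre \<delta> ({} :: 'a set) = 0" if "0 < \<delta>" for \<delta>
  proof -
    have "hausdorff1_pre \<delta> ({} :: 'a set) \<le> (\<Sum>i::nat. ennreal (diameter ({} :: 'a set)))"
      unfolding hausdorff1_pre_def using that by (intro Inf_lower CollectI exI[of _ "\<lambda>_. {}"]) auto
    then show ?thesis by simp
  qed
  then show ?thesis by (simp add: hausdorff1_def)
qed

text \<open>The pair \<open>(a, b)\<close>, read in the coordinates \<open>i\<close> and
  \<open>other i\<close>, parametrises a Lipschitz curve, whose range is rectifiable and so meets
  \<open>S\<close> in a null set; projecting keeps it null. This supplies the hypothesis
  \<open>null\<close> of \<open>exists_potential\<close> for either coordinate.\<close>

lemma purely_unrectifiable1_trace_null:
  fixes S :: "(real ^ 2) set" and a b :: "real \<Rightarrow> real"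
  assumes S: "purely_unrectifiable1 S" and a: "1-lipschitz_on UNIV a" and b: "1-lipschitz_on UNIV b"
  shows "negligible {a t |t. (a t, b t) \<in> (\<lambda>p. (p $ i, p $ other i)) ` S}"
proof -
  define G :: "real \<Rightarrow> real ^ 2" where "G t = (\<chi> k. if k = i then a t else b t)" for t
  have "2-lipschitz_on UNIV G"
  proof (rule lipschitz_onI)
    fix s t
    have "dist (G s) (G t) \<le> \<bar>a s - a t\<bar> + \<bar>b s - b t\<bar>"
      using norm_le_other[of "G s - G t" i] other_neq[of i] by (simp add: G_def dist_norm)
    also have "\<dots> \<le> 2 * dist s t"
      using lipschitz_onD[OF a, of s t] lipschitz_onD[OF b, of s t] by (simp add: dist_real_def)
    finally show "dist (G s) (G t) \<le> 2 * dist s t" .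
  qed simp
  then have "rectifiable1 (range G)"
    unfolding rectifiable1_def
    by (intro exI[of _ "\<lambda>_. UNIV"] exI[of _ "\<lambda>_. G"]) (auto simp: hausdorff1_empty)
  then have "hausdorff1 (S \<inter> range G) = 0"
    using S by (simp add: purely_unrectifiable1_def)
  then have "negligible ((\<lambda>p. p $ i) ` (S \<inter> range G))"
    by (rule negligible_image_hausdorff1_null) (auto intro!: lipschitz_onI simp: dist_vec_nth_le)
  moreover have "{a t |t. (a t, b t) \<in> (\<lambda>p. (p $ i, p $ other i)) ` S} \<subseteq> (\<lambda>p. p $ i) ` (S \<inter> range G)"
  proof
    fix z assume "z \<in> {a t |t. (a t, b t) \<in> (\<lambda>p. (p $ i, p $ other i)) ` S}"
    then obtain t p where p: "p \<in> S" "a t = p $ i" "b t = p $ other i" "z = p $ i" by auto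
    have "p $ k = G t $ k" for k
      using UNIV_other[of i] p by (cases "k = i") (auto simp: G_def)
    then have "p = G t" by (simp add: vec_eq_iff)
    then show "z \<in> (\<lambda>p. p $ i) ` (S \<inter> range G)" using p by auto
  qed
  ultimately show ?thesis by (rule negligible_subset)
qed

text \<open>Near \<open>S\<close> the potential has slope exactly 1 in direction \<open>i\<close>,
  so subtracting it cancels that coordinate and leaves only the \<open>\<delta>\<close>-Lipschitz
  dependence on the other one. The last clause allows any \<open>\<delta>\<close>-Lipschitz cut-off
  \<open>\<eta>\<close>: where \<open>\<eta>\<close> replaces \<open>v\<close>, the slope in
  direction \<open>i\<close> is at most \<open>1 + \<delta>\<close>.\<close>

lemma coordinate_potential:
  fixes S :: "(real ^ 2) set"
  assumes S: "compact S" "purely_unrectifiable1 S" and "0 < \<delta>" "0 < \<epsilon>"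
  obtains r v where "0 < r" "\<And>p. 0 \<le> v p" "\<And>p. v p \<le> \<epsilon>"
    "\<And>p q. p \<in> S \<Longrightarrow> q \<in> S \<Longrightarrow> dist p q < r \<Longrightarrow>
       \<bar>(p $ i - v p) - (q $ i - v q)\<bar> \<le> \<delta> * \<bar>p $ other i - q $ other i\<bar>"
    "\<And>\<eta> p q. (\<And>p q. \<bar>\<eta> p - \<eta> q\<bar> \<le> \<delta> * dist p q) \<Longrightarrow>
       \<bar>(p $ i - min (v p) (\<eta> p)) - (q $ i - min (v q) (\<eta> q))\<bar>
         \<le> (1 + \<delta>) * \<bar>p $ i - q $ i\<bar> + \<delta> * \<bar>p $ other i - q $ other i\<bar>"
proof -
  define S' where "S' = (\<lambda>p. (p $ i, p $ other i)) ` S"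
  have cS: "compact S'"
    unfolding S'_def using S by (intro compact_continuous_image continuous_intros)
  have null: "negligible {a t |t. (a t, b t) \<in> S'}" if "1-lipschitz_on UNIV a" "1-lipschitz_on UNIV b"
    for a b :: "real \<Rightarrow> real"
    unfolding S'_def by (rule purely_unrectifiable1_trace_null[OF S(2) that])
  obtain r w where r: "0 < r" and nn: "\<And>x y. 0 \<le> w x y" and le: "\<And>x y. w x y \<le> \<epsilon>"
    and mono: "\<And>x x' y. x \<le> x' \<Longrightarrow> w x y \<le> w x' y"
    and lip: "\<And>x x' y. x \<le> x' \<Longrightarrow> w x' y \<le> w x y + (x' - x)"
    and vert: "\<And>x y y'. \<bar>w x y - w x y'\<bar> \<le> \<delta> * \<bar>y - y'\<bar>"
    and gain: "\<And>x x' y. x \<le> x' \<Longrightarrow> {x..x'} \<times> {y} \<subseteq> (\<Union>q\<in>S'. ball q r) \<Longrightarrow> w x y + (x' - x) \<le> w x' y"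
  proof (rule exists_potential[OF cS assms(3,4)])
    show "negligible {a t |t. (a t, b t) \<in> S'}" if "1-lipschitz_on UNIV a" "1-lipschitz_on UNIV b"
      for a b :: "real \<Rightarrow> real" by (rule null[OF that])
  qed (rule that)
  define v where "v p = w (p $ i) (p $ other i)" for p :: "real ^ 2"
  show ?thesis
  proof (rule that[of r v])
    fix p q assume pq: "p \<in> S" "q \<in> S" "dist p q < r"
    let ?x = "p $ i" and ?x' = "q $ i" and ?y = "p $ other i"
    have d: "\<bar>?x - ?x'\<bar> < r"
      using pq(3) dist_vec_nth_le[of p i q] by (simp add: dist_real_def)
    \<comment> \<open>The horizontal segment is taken at the height of \<open>p\<close>, so the ball
      about the single point \<open>p\<close> of \<open>S\<close> contains it.\<close>
    have "{min ?x ?x'..max ?x ?x'} \<times> {?y} \<subseteq> ball (?x, ?y) r"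
      using d by (auto simp: dist_Pair_Pair dist_real_def)
    also have "\<dots> \<subseteq> (\<Union>q\<in>S'. ball q r)" using pq by (auto simp: S'_def)
    finally have seg: "{min ?x ?x'..max ?x ?x'} \<times> {?y} \<subseteq> (\<Union>q\<in>S'. ball q r)" .
    have "w ?x ?y - w ?x' ?y = ?x - ?x'"
    proof (cases "?x \<le> ?x'")
      case True
      then show ?thesis using gain[of ?x ?x' ?y] lip[of ?x ?x' ?y] seg by simp
    next
      case False
      then show ?thesis using gain[of ?x' ?x ?y] lip[of ?x' ?x ?y] seg by simp
    qed
    then show "\<bar>(p $ i - v p) - (q $ i - v q)\<bar> \<le> \<delta> * \<bar>p $ other i - q $ other i\<bar>"
      using vert[of ?x' ?y "q $ other i"] by (simp add: v_def)
  next
    fix \<eta> :: "real ^ 2 \<Rightarrow> real" and p q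
    assume \<eta>: "\<And>p q. \<bar>\<eta> p - \<eta> q\<bar> \<le> \<delta> * dist p q"
    \<comment> \<open>The corner of the path from \<open>p\<close> to \<open>q\<close> that changes
      coordinate \<open>i\<close> first and the other one second.\<close>
    define m :: "real ^ 2" where "m = (\<chi> k. if k = i then q $ i else p $ other i)"
    have mi: "m $ i = q $ i" "m $ other i = p $ other i"
      using other_neq[of i] by (auto simp: m_def)
    have "dist p m \<le> \<bar>p $ i - q $ i\<bar>" "dist m q \<le> \<bar>p $ other i - q $ other i\<bar>"
      using norm_le_other[of "p - m" i] norm_le_other[of "m - q" i] by (simp_all add: mi dist_norm)
    then have "\<delta> * dist p m \<le> \<delta> * \<bar>p $ i - q $ i\<bar>" "\<delta> * dist m q \<le> \<delta> * \<bar>p $ other i - q $ other i\<bar>"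
      using \<open>0 < \<delta>\<close> by (auto intro: mult_left_mono)
    then have \<eta>_pm: "\<bar>\<eta> p - \<eta> m\<bar> \<le> \<delta> * \<bar>p $ i - q $ i\<bar>"
      and \<eta>_mq: "\<bar>\<eta> m - \<eta> q\<bar> \<le> \<delta> * \<bar>p $ other i - q $ other i\<bar>"
      using \<eta>[of p m] \<eta>[of m q] by linarith+
    have v_mq: "\<bar>v m - v q\<bar> \<le> \<delta> * \<bar>p $ other i - q $ other i\<bar>"
      using vert[of "q $ i" "p $ other i" "q $ other i"] by (simp add: v_def mi)
    have v_pm: "p $ i \<le> q $ i \<Longrightarrow> v p \<le> v m \<and> v m \<le> v p + (q $ i - p $ i)"
      "q $ i \<le> p $ i \<Longrightarrow> v m \<le> v p \<and> v p \<le> v m + (p $ i - q $ i)"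
      using mono lip by (auto simp: v_def mi)
    define D where "D = \<delta> * \<bar>p $ i - q $ i\<bar>"
    have "0 \<le> D" using \<open>0 < \<delta>\<close> by (simp add: D_def)
    have "\<bar>(p $ i - min (v p) (\<eta> p)) - (q $ i - min (v m) (\<eta> m))\<bar> \<le> \<bar>p $ i - q $ i\<bar> + D"
      using \<eta>_pm v_pm \<open>0 \<le> D\<close> unfolding D_def[symmetric]
      by (smt (verit))
    moreover have "\<bar>min (v m) (\<eta> m) - min (v q) (\<eta> q)\<bar> \<le> \<delta> * \<bar>p $ other i - q $ other i\<bar>"
      using v_mq \<eta>_mq by (smt (verit))
    moreover have "(1 + \<delta>) * \<bar>p $ i - q $ i\<bar> = \<bar>p $ i - q $ i\<bar> + D"
      by (simp add: D_def distrib_right)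
    ultimately show "\<bar>(p $ i - min (v p) (\<eta> p)) - (q $ i - min (v q) (\<eta> q))\<bar>
         \<le> (1 + \<delta>) * \<bar>p $ i - q $ i\<bar> + \<delta> * \<bar>p $ other i - q $ other i\<bar>"
      by (smt (verit))
  qed (use r nn le in \<open>auto simp: v_def\<close>)
qed

section \<open>Assembling the contraction\<close>

text \<open>A segment from inside to outside meets the sphere at some \<open>b\<close>, which
  belongs to both regions, and distances add along the segment through \<open>b\<close>.\<close>

lemma lipschitz_glue_sphere:
  fixes G :: "'a::euclidean_space \<Rightarrow> 'b::metric_space"
  assumes inside: "\<And>p q. norm p \<le> R \<Longrightarrow> norm q \<le> R \<Longrightarrow> dist (G p) (G q) \<le> dist p q"
    and outside: "\<And>p q. R \<le> norm p \<Longrightarrow> R \<le> norm q \<Longrightarrow> dist (G p) (G q) \<le> dist p q"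
  shows "1-lipschitz_on UNIV G"
proof (rule lipschitz_onI)
  have mixed: "dist (G p) (G q) \<le> dist p q" if "norm p \<le> R" "R \<le> norm q" for p q
  proof -
    have "connected (norm ` closed_segment p q)"
      by (intro connected_continuous_image continuous_intros) auto
    then have "R \<in> norm ` closed_segment p q"
      using that by (meson connected_contains_Icc ends_in_segment(1,2) atLeastAtMost_iff image_eqI subset_iff)
    then obtain b where b: "b \<in> closed_segment p q" "norm b = R" by auto
    then have "dist p q = dist p b + dist b q"
      by (simp add: between_mem_segment[symmetric] between)
    moreover have "dist (G p) (G q) \<le> dist (G p) (G b) + dist (G b) (G q)"
      by (rule dist_triangle)
    ultimately show ?thesis
      using inside[of p b] outside[of b q] that b by simp
  qed
  fix p q :: 'a
  show "dist (G p) (G q) \<le> 1 * dist p q"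
    using inside[of p q] outside[of p q] mixed[of p q] mixed[of q p]
    by (simp add: dist_commute) linarith
qed simp

lemma lipschitz_componentwise:
  fixes g :: "'n::finite \<Rightarrow> real \<Rightarrow> real"
  assumes "\<And>i s t. \<bar>g i s - g i t\<bar> \<le> \<bar>s - t\<bar>"
  shows "dist (\<chi> i. g i (p $ i)) (\<chi> i. g i (q $ i)) \<le> dist p (q :: real ^ 'n)"
  unfolding dist_norm using assms by (intro norm_le_componentwise_cart) simp

lemma finite_vec_components:
  fixes A :: "('a ^ 2) set"
  assumes "\<And>i. finite ((\<lambda>v. v $ i) ` A)"
  shows "finite A"
proof (rule finite_imageD)
  have "(\<lambda>v. (v $ 1, v $ 2)) ` A \<subseteq> (\<lambda>v. v $ 1) ` A \<times> (\<lambda>v. v $ 2) ` A" by auto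
  then show "finite ((\<lambda>v. (v $ 1, v $ 2)) ` A)"
    using assms finite_subset by blast
  show "inj_on (\<lambda>v. (v $ 1, v $ 2)) A"
    by (auto simp: inj_on_def vec_eq_iff forall_2)
qed

text \<open>Subtracting the cut-off potentials gives \<open>f\<close>, which is
  \<open>(1 + 2 * \<delta>)\<close>-Lipschitz and the identity outside radius \<open>R + 1\<close>.
  Applying \<open>\<psi>\<close> to each coordinate contracts just enough where \<open>f\<close> may
  expand and keeps bounded displacement on the whole plane, which a global scaling would not. On
  \<open>S\<close> each coordinate of \<open>h\<close> is \<open>\<delta>\<close>-Lipschitz at small
  scales, so a fine cover bounds the measure of its image.\<close>

lemma contracting_perturbation:
  fixes S :: "(real ^ 2) set"
  assumes S: "compact S" "purely_unrectifiable1 S" and H: "hausdorff1 S < ennreal H"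
    and R: "\<And>p. p \<in> S \<Longrightarrow> norm p \<le> R" and R0: "0 \<le> R" and \<delta>: "0 < \<delta>" "\<delta> \<le> 1 / 2"
  obtains h where "1-lipschitz_on UNIV h" "\<And>p i. \<bar>h p $ i - p $ i\<bar> \<le> \<delta> * (2 * R + 7)"
    "\<And>i. emeasure lborel ((\<lambda>p. h p $ i) ` S) \<le> ennreal (2 * \<delta> * H)"
proof -
  have "\<exists>r v. 0 < r \<and> (\<forall>p. 0 \<le> v p \<and> v p \<le> \<delta>) \<and>
    (\<forall>p\<in>S. \<forall>q\<in>S. dist p q < r \<longrightarrow> \<bar>(p $ i - v p) - (q $ i - v q)\<bar> \<le> \<delta> * \<bar>p $ other i - q $ other i\<bar>) \<and>
    (\<forall>\<eta> p q. (\<forall>p q. \<bar>\<eta> p - \<eta> q\<bar> \<le> \<delta> * dist p q) \<longrightarrow>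
       \<bar>(p $ i - min (v p) (\<eta> p)) - (q $ i - min (v q) (\<eta> q))\<bar>
         \<le> (1 + \<delta>) * \<bar>p $ i - q $ i\<bar> + \<delta> * \<bar>p $ other i - q $ other i\<bar>)" for i
  proof (rule coordinate_potential[OF S \<delta>(1) \<delta>(1), of i], goal_cases)
    case (1 r v)
    then show ?case by (intro exI[of _ r] exI[of _ v]) blast
  qed
  then obtain r v where r: "\<And>i. 0 < r i" and v: "\<And>i p. 0 \<le> v i p" "\<And>i p. v i p \<le> \<delta>"
    and near: "\<And>i p q. p \<in> S \<Longrightarrow> q \<in> S \<Longrightarrow> dist p q < r i \<Longrightarrow>
       \<bar>(p $ i - v i p) - (q $ i - v i q)\<bar> \<le> \<delta> * \<bar>p $ other i - q $ other i\<bar>"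
    and glob: "\<And>i \<eta> p q. (\<And>p q. \<bar>\<eta> p - \<eta> q\<bar> \<le> \<delta> * dist p q) \<Longrightarrow>
       \<bar>(p $ i - min (v i p) (\<eta> p)) - (q $ i - min (v i q) (\<eta> q))\<bar>
         \<le> (1 + \<delta>) * \<bar>p $ i - q $ i\<bar> + \<delta> * \<bar>p $ other i - q $ other i\<bar>"
    by metis
  \<comment> \<open>The cut-off is at least \<open>\<delta>\<close> on the ball of radius
    \<open>R\<close>, so it leaves the potentials unchanged on \<open>S\<close>, and it vanishes
    beyond radius \<open>R + 1\<close>.\<close>
  define \<eta> where "\<eta> p = \<delta> * max 0 (R + 1 - norm p)" for p :: "real ^ 2"
  have \<eta>: "\<bar>\<eta> p - \<eta> q\<bar> \<le> \<delta> * dist p q" for p q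
  proof -
    have "\<bar>max 0 (R + 1 - norm p) - max 0 (R + 1 - norm q)\<bar> \<le> dist p q"
      using norm_triangle_ineq3[of p q] by (auto simp: dist_norm)
    then show ?thesis
      using \<delta> by (simp add: \<eta>_def abs_mult flip: right_diff_distrib)
  qed
  have \<eta>0: "0 \<le> \<eta> p" for p using \<delta> by (simp add: \<eta>_def)
  define u where "u i p = min (v i p) (\<eta> p)" for i p
  have u: "0 \<le> u i p" "u i p \<le> \<delta>" for i p using v[of i p] \<eta>0[of p] by (auto simp: u_def)
  have u_out: "u i p = 0" if "R + 1 \<le> norm p" for i p
    using v(1)[of i p] that by (simp add: u_def \<eta>_def)
  have u_S: "u i p = v i p" if "p \<in> S" for i p
  proof -
    have "\<delta> * 1 \<le> \<eta> p" unfolding \<eta>_def using R[OF that] \<delta> by (intro mult_left_mono) auto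
    then show ?thesis using v(2)[of i p] by (simp add: u_def)
  qed
  define f :: "real ^ 2 \<Rightarrow> real ^ 2" where "f p = (\<chi> i. p $ i - u i p)" for p
  have f_lip: "dist (f p) (f q) \<le> (1 + 2 * \<delta>) * dist p q" for p q
  proof -
    have "norm (f p - f q) \<le> ((1 + \<delta>) + \<delta>) * norm (p - q)"
    proof (rule norm_le_of_components)
      show "\<bar>(f p - f q) $ i\<bar> \<le> (1 + \<delta>) * \<bar>(p - q) $ i\<bar> + \<delta> * \<bar>(p - q) $ other i\<bar>" for i
        using glob[OF \<eta>, of p i q] by (simp add: f_def u_def)
    qed (use \<delta> in auto)
    then show ?thesis by (simp add: dist_norm algebra_simps)
  qed
  \<comment> \<open>On the ball of radius \<open>R + 1\<close> the coordinates of \<open>f p\<close>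
    are at most \<open>R + 1 + \<delta>\<close> in modulus, hence within the range where
    \<open>\<psi>\<close> contracts.\<close>
  define A where "A = R + 2"
  define \<kappa> where "\<kappa> = 2 * \<delta> / (1 + 2 * \<delta>)"
  have \<kappa>: "0 \<le> \<kappa>" "\<kappa> \<le> 2 * \<delta>" "\<kappa> \<le> 1" "(1 - \<kappa>) * (1 + 2 * \<delta>) = 1"
    using \<delta> by (auto simp: \<kappa>_def field_simps)
  \<comment> \<open>\<open>\<psi>\<close> has slope \<open>1 - \<kappa> = 1 / (1 + 2\<delta>)\<close> on \<open>[-A, A]\<close> and slope \<open>1\<close> outside.\<close>
  define \<psi> where "\<psi> s = s - \<kappa> * max (-A) (min A s)" for s
  have A0: "0 \<le> A" using R0 by (simp add: A_def)
  have \<psi>1: "\<bar>\<psi> s - \<psi> t\<bar> \<le> \<bar>s - t\<bar>" for s t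
  proof -
    have "\<bar>\<psi> s - \<psi> t\<bar> \<le> \<bar>s - t\<bar>" if "s \<le> t" for s t
    proof -
      define c where "c = max (-A) (min A t) - max (-A) (min A s)"
      have "0 \<le> c" "c \<le> t - s" using that by (auto simp: c_def)
      then have "0 \<le> \<kappa> * c" "\<kappa> * c \<le> t - s"
        using \<kappa> mult_left_le_one_le[of c \<kappa>] by auto
      moreover have "\<psi> t - \<psi> s = (t - s) - \<kappa> * c" by (simp add: \<psi>_def c_def algebra_simps)
      ultimately show ?thesis by simp
    qed
    from this[of s t] this[of t s] show ?thesis by (cases "s \<le> t") auto
  qed
  have \<psi>2: "\<psi> s - \<psi> t = (1 - \<kappa>) * (s - t)" if "\<bar>s\<bar> \<le> A" "\<bar>t\<bar> \<le> A" for s t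
    using that by (simp add: \<psi>_def abs_le_iff max_def min_def algebra_simps)
  have \<psi>3: "\<bar>\<psi> s - s\<bar> \<le> \<delta> * (2 * A)" for s
  proof -
    have "\<kappa> * \<bar>max (-A) (min A s)\<bar> \<le> (2 * \<delta>) * A"
      using \<kappa> A0 \<delta> by (intro mult_mono) auto
    then show ?thesis using \<kappa> by (simp add: \<psi>_def abs_mult)
  qed
  define h :: "real ^ 2 \<Rightarrow> real ^ 2" where "h p = (\<chi> i. \<psi> (f p $ i))" for p
  have h1: "1-lipschitz_on UNIV h"
  proof (rule lipschitz_glue_sphere[of "R + 1"])
    fix p q :: "real ^ 2" assume "norm p \<le> R + 1" "norm q \<le> R + 1"
    moreover have "\<bar>f p $ i\<bar> \<le> A" if "norm p \<le> R + 1" for p i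
      using component_le_norm_cart[of p i] u[of i p] \<delta> that by (simp add: f_def A_def)
    ultimately have "\<bar>f p $ i\<bar> \<le> A" "\<bar>f q $ i\<bar> \<le> A" for i
      by blast+
    then have "h p - h q = (1 - \<kappa>) *\<^sub>R (f p - f q)"
      by (simp add: vec_eq_iff h_def \<psi>2)
    then have "dist (h p) (h q) = (1 - \<kappa>) * dist (f p) (f q)"
      using \<kappa> by (simp add: dist_norm)
    also have "\<dots> \<le> (1 - \<kappa>) * ((1 + 2 * \<delta>) * dist p q)"
      using f_lip \<kappa> by (intro mult_left_mono) auto
    also have "\<dots> = dist p q" using \<kappa>(4) by (simp add: mult.assoc[symmetric])
    finally show "dist (h p) (h q) \<le> dist p q" .
  next
    fix p q :: "real ^ 2" assume "R + 1 \<le> norm p" "R + 1 \<le> norm q"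
    then have "f p = p" "f q = q" by (simp_all add: f_def u_out vec_eq_iff)
    then show "dist (h p) (h q) \<le> dist p q"
      unfolding h_def using lipschitz_componentwise[of "\<lambda>_. \<psi>" p q] \<psi>1 by simp
  qed
  show ?thesis
  proof (rule that[OF h1])
    fix p i
    have "\<bar>h p $ i - p $ i\<bar> \<le> \<bar>\<psi> (f p $ i) - f p $ i\<bar> + \<bar>f p $ i - p $ i\<bar>"
      by (simp add: h_def)
    also have "\<dots> \<le> \<delta> * (2 * A) + \<delta>"
      using \<psi>3 u[of i p] by (intro add_mono) (auto simp: f_def)
    also have "\<dots> \<le> \<delta> * (2 * R + 7)" using \<delta> by (simp add: A_def algebra_simps)
    finally show "\<bar>h p $ i - p $ i\<bar> \<le> \<delta> * (2 * R + 7)" .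
  next
    fix i
    \<comment> \<open>Mesh \<open>r i / 2\<close> puts any two points of one covering set strictly
      within distance \<open>r i\<close>, so \<open>near\<close> applies to them.\<close>
    obtain U where U: "S \<subseteq> (\<Union>n. U n)" "\<And>n. bounded (U n)" "\<And>n. diameter (U n) \<le> r i / 2"
      "(\<Sum>n. ennreal (diameter (U n))) < ennreal H"
      using hausdorff1_pre_cover[OF H, of "r i / 2"] r[of i] by auto
    have hU: "\<bar>h p $ i - h q $ i\<bar> \<le> \<delta> * dist p q" if "p \<in> S \<inter> U n" "q \<in> S \<inter> U n" for n p q
    proof -
      have "dist p q \<le> diameter (U n)" using that U(2) by (intro diameter_bounded_bound) auto
      then have "dist p q < r i" using U(3)[of n] r[of i] by simp
      have "\<bar>h p $ i - h q $ i\<bar> \<le> \<bar>f p $ i - f q $ i\<bar>" by (simp add: h_def \<psi>1)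
      also have "\<dots> \<le> \<delta> * \<bar>p $ other i - q $ other i\<bar>"
        using near[OF _ _ \<open>dist p q < r i\<close>] that by (simp add: f_def u_S)
      also have "\<dots> \<le> \<delta> * dist p q"
        using \<delta> dist_vec_nth_le[of p "other i" q] by (intro mult_left_mono) (auto simp: dist_real_def)
      finally show ?thesis .
    qed
    obtain T where T: "T \<in> sets lborel" "(\<lambda>p. h p $ i) ` S \<subseteq> T"
        "emeasure lborel T \<le> ennreal (2 * \<delta>) * (\<Sum>n. ennreal (diameter (U n)))"
    proof (rule image_cover_outer[OF U(2,1) less_imp_le[OF \<delta>(1)], of "\<lambda>p. h p $ i"])
      show "\<bar>h p $ i - h q $ i\<bar> \<le> \<delta> * dist p q" if "p \<in> S \<inter> U n" "q \<in> S \<inter> U n" for n p q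
        using hU[OF that] .
    qed
    have "emeasure lborel ((\<lambda>p. h p $ i) ` S) \<le> emeasure lborel T"
      using T by (intro emeasure_mono) auto
    also have "\<dots> \<le> ennreal (2 * \<delta>) * ennreal H"
      using T(3) U(4) by (meson less_imp_le mult_left_mono order_trans zero_le)
    also have "\<dots> = ennreal (2 * \<delta> * H)"
      using \<delta> by (simp add: ennreal_mult')
    finally show "emeasure lborel ((\<lambda>p. h p $ i) ` S) \<le> ennreal (2 * \<delta> * H)" .
  qed
qed

lemma finite_image_perturbation:
  fixes S :: "(real ^ 2) set"
  assumes S: "compact S" "purely_unrectifiable1 S" "hausdorff1 S < \<infinity>" and "0 < e"
  obtains F :: "real ^ 2 \<Rightarrow> real ^ 2" where
    "1-lipschitz_on UNIV F" "\<And>p. dist (F p) p < e" "finite (F ` S)"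
proof -
  obtain H0 where H0: "hausdorff1 S = ennreal H0" "0 \<le> H0"
    using S(3) by (cases "hausdorff1 S") auto
  define H where "H = H0 + 1"
  have H: "hausdorff1 S < ennreal H" "0 < H" using H0 by (auto simp: H_def ennreal_less_iff)
  obtain R where R: "\<And>p. p \<in> S \<Longrightarrow> norm p \<le> R" "0 < R"
    using compact_imp_bounded[OF S(1)] by (auto simp: bounded_pos)
  \<comment> \<open>Per coordinate, \<open>h\<close> moves points by at most
    \<open>\<delta> * (2 * R + 7)\<close> and the collapse by at most
    \<open>\<delta> * (4 * H)\<close>. The choice of \<open>\<delta>\<close> below keeps the sum
    over both coordinates under \<open>e\<close>.\<close>
  define M where "M = 2 * R + 7 + 4 * H"
  have M: "0 < M" using R H by (simp add: M_def)
  define \<delta> where "\<delta> = min (1 / 2) (e / (4 * M))"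
  have \<delta>: "0 < \<delta>" "\<delta> \<le> 1 / 2" using M \<open>0 < e\<close> by (auto simp: \<delta>_def)
  have \<delta>M: "\<delta> * M < e / 2"
  proof -
    have "\<delta> * M \<le> e / (4 * M) * M" using M by (intro mult_right_mono) (auto simp: \<delta>_def)
    also have "\<dots> < e / 2" using M \<open>0 < e\<close> by simp
    finally show ?thesis .
  qed
  obtain h where h: "1-lipschitz_on UNIV h" "\<And>p i. \<bar>h p $ i - p $ i\<bar> \<le> \<delta> * (2 * R + 7)"
    "\<And>i. emeasure lborel ((\<lambda>p. h p $ i) ` S) \<le> ennreal (2 * \<delta> * H)"
    using contracting_perturbation[OF S(1,2) H(1) R(1) less_imp_le[OF R(2)] \<delta>] by blast
  define K where "K i = (\<lambda>p. h p $ i) ` S" for i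
  have "compact (K i)" for i
    unfolding K_def using lipschitz_on_continuous_on[OF h(1)] S(1)
    by (intro compact_continuous_image continuous_intros) (auto intro: continuous_on_subset)
  \<comment> \<open>Doubling the bound \<open>2 * \<delta> * H\<close> yields the strict inequality
    that \<open>collapse_compact\<close> asks for.\<close>
  moreover have "emeasure lborel (K i) < ennreal (4 * \<delta> * H)" for i
    unfolding K_def using \<delta> H by (intro le_less_trans[OF h(3)]) (auto simp: ennreal_less_iff)
  ultimately have "\<exists>g. (\<forall>s t. \<bar>g s - g t\<bar> \<le> \<bar>s - t\<bar>) \<and> (\<forall>t. \<bar>g t - t\<bar> \<le> 4 * \<delta> * H) \<and> finite (g ` K i)" for i
    by (metis collapse_compact)
  then obtain g where g: "\<And>i s t. \<bar>g i s - g i t\<bar> \<le> \<bar>s - t\<bar>" "\<And>i t. \<bar>g i t - t\<bar> \<le> 4 * \<delta> * H"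
    "\<And>i. finite (g i ` K i)" by metis
  define F :: "real ^ 2 \<Rightarrow> real ^ 2" where "F p = (\<chi> i. g i (h p $ i))" for p
  show ?thesis
  proof (rule that[of F])
    show "1-lipschitz_on UNIV F"
    proof (rule lipschitz_onI)
      fix p q
      have "dist (F p) (F q) \<le> dist (h p) (h q)"
        unfolding F_def by (rule lipschitz_componentwise[OF g(1)])
      also have "\<dots> \<le> 1 * dist p q" by (rule lipschitz_onD[OF h(1)]) auto
      finally show "dist (F p) (F q) \<le> 1 * dist p q" .
    qed simp
    show "dist (F p) p < e" for p
    proof -
      have "\<bar>(F p - p) $ i\<bar> \<le> \<delta> * M" for i
        using g(2)[of i "h p $ i"] h(2)[of p i] by (simp add: F_def M_def algebra_simps)
      from this[of 1] this[of "other 1"] have "dist (F p) p \<le> 2 * (\<delta> * M)"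
        using norm_le_other[of "F p - p" 1] by (simp add: dist_norm)
      then show ?thesis using \<delta>M by simp
    qed
    show "finite (F ` S)"
    proof (rule finite_vec_components)
      show "finite ((\<lambda>v. v $ i) ` F ` S)" for i
        using g(3)[of i] by (simp add: F_def K_def image_image)
    qed
  qed
qed

theorem proposition1p1:
  fixes S :: "(real ^ 2) set"
  assumes "compact S"
    and "purely_unrectifiable1 S"
    and "hausdorff1 S < \<infinity>"
  shows "\<exists>f :: nat \<Rightarrow> real ^ 2 \<Rightarrow> real ^ 2.
           (\<forall>i. 1-lipschitz_on UNIV (f i)) \<and>
           uniform_limit UNIV f (\<lambda>x. x) sequentially \<and>
           (\<forall>i. finite (f i ` S))"
proof -
  have "\<exists>F :: real ^ 2 \<Rightarrow> real ^ 2. 1-lipschitz_on UNIV F \<and> (\<forall>p. dist (F p) p < 1 / real (Suc n)) \<and> finite (F ` S)" for n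
    by (rule finite_image_perturbation[OF assms, of "1 / real (Suc n)"]) auto
  then obtain f :: "nat \<Rightarrow> real ^ 2 \<Rightarrow> real ^ 2" where
    f: "\<And>n. 1-lipschitz_on UNIV (f n)" "\<And>n p. dist (f n p) p < 1 / real (Suc n)" "\<And>n. finite (f n ` S)"
    by metis
  have "uniform_limit UNIV f (\<lambda>x. x) sequentially"
  proof (rule uniform_limitI)
    fix e :: real assume "e > 0"
    then obtain N where N: "1 / real (Suc N) < e" using nat_approx_posE by blast
    have "dist (f n p) p < e" if "n \<ge> N" for n p
    proof -
      have "1 / real (Suc n) \<le> 1 / real (Suc N)" using that by (simp add: frac_le)
      then show ?thesis using f(2)[of n p] N by linarith
    qed
    then show "\<forall>\<^sub>F n in sequentially. \<forall>p\<in>UNIV. dist (f n p) p < e"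
      by (auto simp: eventually_sequentially)
  qed
  with f show ?thesis by blast
qed

end
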